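(* Assume that $\mathbb P=\mathbb Q$, that $\alpha_k>\lim_{x\to+\infty}l(x)$ for $k\in\{1,\ldots,n\}$, and that $$\mathbb E[S_n+l^{-1}(\alpha_n)|\mathcal F_k]\geq S_k+l^{-1}(\alpha_k)$$ for any $k\in\{1,\ldots,n\}$, where $l^{-1}(\alpha):=\inf\{x\in\mathbf R\,|\,l(x)\leq\alpha\}$. Then $$V^{EU}_0(\alpha_1,\ldots,\alpha_n)=V^{TC}_0(\alpha_1,\ldots,\alpha_n)=V^{LB}_0(\alpha_1,\ldots,\alpha_n)=\mathbb E[S_n]+l^{-1}(\alpha_n).$$
   Context: Setting: $(\Omega,\mathcal F,\mathbb P)$ is a probability space with a discrete filtration $\mathbb F=(\mathcal F_k)_{k=0}^n$, $n\ge 1$, with $\mathcal F_0$ trivial; $\mathbb Q$ is a probability measure equivalent to $\mathbb P$; $S_0=0$ and $S_k=P_1+\dots+P_k$, where each $P_i$ is $\mathcal F_i$-measurable with $\mathbb E^{\mathbb Q}[|P_i|]<\infty$. The loss function $l:\mathbf R\to\mathbf R$ is convex, decreasing (in the weak sense) and bounded from below; $\alpha_1,\ldots,\alpha_n$ are real numbers. All supermartingales are with respect to $\mathbb F$. When $\mathbb P=\mathbb Q$, $\mathbb E$ denotes the common expectation. $V^{EU}_0(\alpha_1,\ldots,\alpha_n)$, $V^{TC}_0(\alpha_1,\ldots,\alpha_n)$ and $V^{LB}_0(\alpha_1,\ldots,\alpha_n)$ denote the infimum of $M_0$ over all $(M_k)_{k=0}^n$ in $\mathcal M_{EU}$, $\mathcal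 M_{TC}$ and $\mathcal M_{LB}$ respectively, where: $\mathcal M_{EU}$ is the set of all $\mathbb Q$-supermartingales $(M_k)_{k=0}^n$ with $\mathbb E^{\mathbb P}[l(M_k-S_k)]\leq\alpha_k$ for $k=1,\ldots,n$; $\mathcal M_{TC}$ is the set of all $\mathbb Q$-supermartingales $(M_k)_{k=0}^n$ with $\mathbb E^{\mathbb P}[l(M_k-S_k)|\mathcal F_{k-1}]\leq\alpha_k$ a.s. for $k=1,\ldots,n$; $\mathcal M_{LB}$ is the set of all $\mathbb Q$-supermartingales $(M_k)_{k=0}^n$ with $\mathbb E^{\mathbb P}[\max_{k=1,\ldots,n}\{l(M_k-S_k)-\alpha_k\}]\leq 0$. *)

theory Defs
  imports "HOL-Probability.Probability"
begin

definition equivalent_measures :: "'a measure \<Rightarrow> 'a measure \<Rightarrow> bool" where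
  "equivalent_measures P Q \<longleftrightarrow>
     sets P = sets Q \<and> absolutely_continuous P Q \<and> absolutely_continuous Q P"

text \<open>Only the time points up to \<open>n\<close> matter, and only the \<open>\<sigma>\<close>-algebra of each \<open>F k\<close> is used.\<close>

definition finite_filtration :: "'a measure \<Rightarrow> nat \<Rightarrow> (nat \<Rightarrow> 'a measure) \<Rightarrow> bool" where
  "finite_filtration P n F \<longleftrightarrow>
     (\<forall>k\<le>n. subalgebra P (F k)) \<and>
     (\<forall>j k. j \<le> k \<and> k \<le> n \<longrightarrow> sets (F j) \<subseteq> sets (F k))"

text \<open>Triviality modulo null sets; this includes the case \<open>sets F = {{}, space P}\<close>.\<close>

definition trivial_subalgebra :: "'a measure \<Rightarrow> 'a measure \<Rightarrow> bool" where
  "trivial_subalgebra P F \<longleftrightarrow>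
     (\<forall>A\<in>sets F. measure P A = 0 \<or> measure P A = 1)"

definition supermartingale ::
  "'a measure \<Rightarrow> nat \<Rightarrow> (nat \<Rightarrow> 'a measure) \<Rightarrow> (nat \<Rightarrow> 'a \<Rightarrow> real) \<Rightarrow> bool" where
  "supermartingale Q n F M \<longleftrightarrow>
     (\<forall>k\<le>n. M k \<in> borel_measurable (F k) \<and> integrable Q (M k)) \<and>
     (\<forall>j k. j \<le> k \<and> k \<le> n \<longrightarrow> (AE \<omega> in Q. real_cond_exp Q (F j) (M k) \<omega> \<le> M j \<omega>))"

text \<open>
  Extended (conditional) expectations, as the difference of those of the positive and the negative
  part. They are needed because \<open>l (M k - S k)\<close> is bounded from below but need not be integrable
  (whereas the Bochner integral of a non-integrable function is \<open>0\<close>), and because the generalised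
  inverse of \<open>l\<close> below can be \<open>-\<infinity>\<close>. Note that \<open>e2ennreal\<close> maps negative values to \<open>0\<close>.
\<close>

definition ereal_expectation :: "'a measure \<Rightarrow> ('a \<Rightarrow> ereal) \<Rightarrow> ereal" where
  "ereal_expectation P X =
     enn2ereal (\<integral>\<^sup>+ \<omega>. e2ennreal (X \<omega>) \<partial>P) - enn2ereal (\<integral>\<^sup>+ \<omega>. e2ennreal (- X \<omega>) \<partial>P)"

definition ereal_cond_exp :: "'a measure \<Rightarrow> 'a measure \<Rightarrow> ('a \<Rightarrow> ereal) \<Rightarrow> 'a \<Rightarrow> ereal" where
  "ereal_cond_exp P F X \<omega> =
     enn2ereal (nn_cond_exp P F (\<lambda>\<omega>. e2ennreal (X \<omega>)) \<omega>)
   - enn2ereal (nn_cond_exp P F (\<lambda>\<omega>. e2ennreal (- X \<omega>)) \<omega>)"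

lemma ereal_expectation_eq_integral:
  assumes "integrable P X"
  shows "ereal_expectation P (\<lambda>\<omega>. ereal (X \<omega>)) = ereal (\<integral>\<omega>. X \<omega> \<partial>P)"
proof -
  have "(\<integral>\<^sup>+ \<omega>. ennreal (X \<omega>) \<partial>P) < \<infinity>" "(\<integral>\<^sup>+ \<omega>. ennreal (- X \<omega>) \<partial>P) < \<infinity>"
    using assms by (simp_all add: real_integrable_def top.not_eq_extremum)
  then obtain a b where ab: "a \<ge> 0" "b \<ge> 0" "(\<integral>\<^sup>+ \<omega>. ennreal (X \<omega>) \<partial>P) = ennreal a"
      "(\<integral>\<^sup>+ \<omega>. ennreal (- X \<omega>) \<partial>P) = ennreal b"
    by (metis ennreal_cases infinity_ennreal_def less_irrefl)
  then show ?thesis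
    by (simp add: ereal_expectation_def real_lebesgue_integral_def[OF assms])
qed

lemma (in finite_measure_subalgebra) ereal_cond_exp_eq_real_cond_exp:
  assumes "integrable M X"
  shows "AE \<omega> in M. ereal_cond_exp M F (\<lambda>\<omega>. ereal (X \<omega>)) \<omega> = ereal (real_cond_exp M F X \<omega>)"
proof -
  have [measurable]: "X \<in> borel_measurable M" using assms by auto
  have fin: "AE \<omega> in M. nn_cond_exp M F (\<lambda>\<omega>. ennreal (Y \<omega>)) \<omega> \<noteq> \<infinity>"
    if "integrable M Y" for Y :: "'a \<Rightarrow> real"
  proof -
    have [measurable]: "Y \<in> borel_measurable M" using that by auto
    have "(\<integral>\<^sup>+ \<omega>. nn_cond_exp M F (\<lambda>\<omega>. ennreal (Y \<omega>)) \<omega> \<partial>M) = (\<integral>\<^sup>+ \<omega>. ennreal (Y \<omega>) \<partial>M)"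
      using nn_cond_exp_intg[of "\<lambda>_. 1" "\<lambda>\<omega>. ennreal (Y \<omega>)"] by simp
    then show ?thesis
      using that by (intro nn_integral_noteq_infinite) (auto simp: real_integrable_def)
  qed
  show ?thesis
    using fin[OF assms] fin[OF integrable_minus[OF assms]]
  proof eventually_elim
    case (elim \<omega>)
    obtain a b where "a \<ge> 0" "b \<ge> 0" "nn_cond_exp M F (\<lambda>\<omega>. ennreal (X \<omega>)) \<omega> = ennreal a"
      "nn_cond_exp M F (\<lambda>\<omega>. ennreal (- X \<omega>)) \<omega> = ennreal b"
      using elim by (metis ennreal_cases infinity_ennreal_def)
    then show ?case
      by (simp add: ereal_cond_exp_def real_cond_exp_def)
  qed
qed

definition gen_inverse :: "(real \<Rightarrow> real) \<Rightarrow> real \<Rightarrow> ereal" where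
  "gen_inverse l a = Inf (ereal ` {x. l x \<le> a})"

definition partial_sum :: "(nat \<Rightarrow> 'a \<Rightarrow> real) \<Rightarrow> nat \<Rightarrow> 'a \<Rightarrow> real" where
  "partial_sum X k \<omega> = (\<Sum>i=1..k. X i \<omega>)"

definition M_EU ::
  "'a measure \<Rightarrow> 'a measure \<Rightarrow> nat \<Rightarrow> (nat \<Rightarrow> 'a measure) \<Rightarrow> (nat \<Rightarrow> 'a \<Rightarrow> real) \<Rightarrow>
   (real \<Rightarrow> real) \<Rightarrow> (nat \<Rightarrow> real) \<Rightarrow> (nat \<Rightarrow> 'a \<Rightarrow> real) set" where
  "M_EU P Q n F S l \<alpha> =
     {M. supermartingale Q n F M \<and>
         (\<forall>k\<in>{1..n}. ereal_expectation P (\<lambda>\<omega>. ereal (l (M k \<omega> - S k \<omega>))) \<le> ereal (\<alpha> k))}"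

definition M_TC ::
  "'a measure \<Rightarrow> 'a measure \<Rightarrow> nat \<Rightarrow> (nat \<Rightarrow> 'a measure) \<Rightarrow> (nat \<Rightarrow> 'a \<Rightarrow> real) \<Rightarrow>
   (real \<Rightarrow> real) \<Rightarrow> (nat \<Rightarrow> real) \<Rightarrow> (nat \<Rightarrow> 'a \<Rightarrow> real) set" where
  "M_TC P Q n F S l \<alpha> =
     {M. supermartingale Q n F M \<and>
         (\<forall>k\<in>{1..n}. AE \<omega> in P.
            ereal_cond_exp P (F (k - 1)) (\<lambda>\<omega>. ereal (l (M k \<omega> - S k \<omega>))) \<omega> \<le> ereal (\<alpha> k))}"

definition M_LB ::
  "'a measure \<Rightarrow> 'a measure \<Rightarrow> nat \<Rightarrow> (nat \<Rightarrow> 'a measure) \<Rightarrow> (nat \<Rightarrow> 'a \<Rightarrow> real) \<Rightarrow>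
   (real \<Rightarrow> real) \<Rightarrow> (nat \<Rightarrow> real) \<Rightarrow> (nat \<Rightarrow> 'a \<Rightarrow> real) set" where
  "M_LB P Q n F S l \<alpha> =
     {M. supermartingale Q n F M \<and>
         ereal_expectation P (\<lambda>\<omega>. ereal (MAX k\<in>{1..n}. l (M k \<omega> - S k \<omega>) - \<alpha> k)) \<le> 0}"

text \<open>
  As \<open>F 0\<close> is trivial, \<open>M 0\<close> is almost surely equal to a constant \<open>m\<close>, which is its value.
  The infimum is taken in the extended reals, hence is \<open>\<infinity>\<close> if no process is admissible.
\<close>

definition inf_initial_value :: "'a measure \<Rightarrow> (nat \<Rightarrow> 'a \<Rightarrow> real) set \<Rightarrow> ereal" where
  "inf_initial_value Q \<M> = Inf {ereal m | m M. M \<in> \<M> \<and> (AE \<omega> in Q. M 0 \<omega> = m)}"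

definition V_EU ::
  "'a measure \<Rightarrow> 'a measure \<Rightarrow> nat \<Rightarrow> (nat \<Rightarrow> 'a measure) \<Rightarrow> (nat \<Rightarrow> 'a \<Rightarrow> real) \<Rightarrow>
   (real \<Rightarrow> real) \<Rightarrow> (nat \<Rightarrow> real) \<Rightarrow> ereal" where
  "V_EU P Q n F S l \<alpha> = inf_initial_value Q (M_EU P Q n F S l \<alpha>)"

definition V_TC ::
  "'a measure \<Rightarrow> 'a measure \<Rightarrow> nat \<Rightarrow> (nat \<Rightarrow> 'a measure) \<Rightarrow> (nat \<Rightarrow> 'a \<Rightarrow> real) \<Rightarrow>
   (real \<Rightarrow> real) \<Rightarrow> (nat \<Rightarrow> real) \<Rightarrow> ereal" where
  "V_TC P Q n F S l \<alpha> = inf_initial_value Q (M_TC P Q n F S l \<alpha>)"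

definition V_LB ::
  "'a measure \<Rightarrow> 'a measure \<Rightarrow> nat \<Rightarrow> (nat \<Rightarrow> 'a measure) \<Rightarrow> (nat \<Rightarrow> 'a \<Rightarrow> real) \<Rightarrow>
   (real \<Rightarrow> real) \<Rightarrow> (nat \<Rightarrow> real) \<Rightarrow> ereal" where
  "V_LB P Q n F S l \<alpha> = inf_initial_value Q (M_LB P Q n F S l \<alpha>)"

end

theory Submission
  imports Defs
begin

text \<open>
  Write \<open>c k\<close> for the generalised inverse of \<open>l\<close> at \<open>\<alpha> k\<close>. Each of the three constraints implies
  \<open>E[l (M n - S n)] \<le> \<alpha> n\<close>, so Jensen's inequality gives \<open>E[M n] \<ge> E[S n] + c n\<close>, and
  \<open>M 0 \<ge> E[M n]\<close> by the supermartingale property. The bound is attained by the martingale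
  \<open>M k = E[S n | F k] + c n\<close>: the hypothesis says exactly that \<open>M k - S k \<ge> c k\<close>, hence
  \<open>l (M k - S k) \<le> \<alpha> k\<close> almost surely, which is stronger than all three constraints.
  If \<open>l\<close> is constant, then \<open>c n = -\<infinity>\<close> and every constant process is admissible; otherwise \<open>l\<close>
  is unbounded above by convexity and every \<open>c k\<close> is finite.
\<close>

section \<open>The loss function and its generalised inverse\<close>

text \<open>\<open>Lim\<close> is a definite description, so the third hypothesis is informative
  only once convergence is known. A decreasing function bounded from below tends to its infimum, and
  a number above the infimum lies above some value of \<open>l\<close>.\<close>

lemma antimono_less_Lim_at_top:
  fixes l :: "real \<Rightarrow> real"
  assumes "antimono l" "bdd_below (range l)" "Lim at_top l < a"
  shows "\<exists>x. l x < a"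
proof -
  have "(l \<longlongrightarrow> (INF x. l x)) at_top"
  proof (rule order_tendstoI)
    fix b assume "b < (INF x. l x)"
    then show "\<forall>\<^sub>F x in at_top. b < l x"
      using cINF_lower[OF assms(2)] by (intro always_eventually allI) (metis UNIV_I less_le_trans)
  next
    fix b assume "(INF x. l x) < b"
    then obtain x where x: "l x < b"
      using cINF_less_iff[OF _ assms(2)] by auto
    show "\<forall>\<^sub>F x in at_top. l x < b"
      using eventually_ge_at_top[of x]
      by eventually_elim (meson x antimonoD[OF assms(1)] le_less_trans)
  qed
  then have "(INF x. l x) < a"
    using assms(3) by (simp add: tendsto_Lim)
  then show ?thesis
    using cINF_less_iff[OF _ assms(2)] by auto
qed

text \<open>Outside an interval a convex function lies above the line through its values at the
  endpoints. A decreasing nonconstant \<open>l\<close> has such a line of negative slope, which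
  grows beyond every bound to the left.\<close>

lemma convex_on_antimono_unbounded:
  fixes l :: "real \<Rightarrow> real"
  assumes "convex_on UNIV l" "antimono l" "l x \<noteq> l y"
  shows "\<exists>z. a < l z"
proof -
  obtain u v where uv: "u < v" "l v < l u"
    using assms(2,3) by (metis antimonoD linorder_neqE_linordered_idom order_le_less)
  \<comment> \<open>At \<open>z\<close>, the line through the values at \<open>u\<close> and
    \<open>v\<close> takes the value \<open>l u + t * (l u - l v)\<close>. This \<open>t\<close>
    makes that value equal to \<open>l u + |a - l u| + 1\<close>, which exceeds
    \<open>a\<close>.\<close>
  define t where "t = (\<bar>a - l u\<bar> + 1) / (l u - l v)"
  define z where "z = u - t * (v - u)"
  have t: "t > 0" "t * (l u - l v) = \<bar>a - l u\<bar> + 1"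
    using uv by (auto simp: t_def)
  have weight: "1 - t / (1 + t) = 1 / (1 + t)"
    using t(1) by (simp add: field_simps)
  \<comment> \<open>Convexity is used with \<open>u\<close> as the interior point of the segment
    from \<open>z\<close> to \<open>v\<close>; solving for \<open>l z\<close> gives the extrapolated
    bound.\<close>
  have "u = (1 - t / (1 + t)) * z + (t / (1 + t)) * v"
    unfolding weight using t(1) by (simp add: z_def divide_simps) (simp add: algebra_simps)
  then have "l u \<le> (1 - t / (1 + t)) * l z + (t / (1 + t)) * l v"
    using convex_onD[OF assms(1), of "t / (1 + t)" z v] t(1) by simp
  also have "\<dots> = (l z + t * l v) / (1 + t)"
    unfolding weight by (simp add: add_divide_distrib)
  finally have "l u + t * (l u - l v) \<le> l z"
    using t(1) by (simp add: pos_le_divide_eq algebra_simps)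
  then show ?thesis
    using t(2) by (intro exI[of _ z]) linarith
qed

text \<open>The sublevel set is closed by continuity, nonempty because of \<open>x\<close>, and
  bounded below by \<open>y\<close> because \<open>l\<close> decreases. Hence its infimum is a real
  minimum, and \<open>l c \<le> a\<close> holds at the infimum itself.\<close>

lemma gen_inverse_eq_ereal:
  assumes "continuous_on UNIV l" "antimono l" "l x \<le> a" "a < l y"
  obtains c where "gen_inverse l a = ereal c" "l c \<le> a" "\<And>x. l x \<le> a \<Longrightarrow> c \<le> x"
proof -
  have bdd: "bdd_below {x. l x \<le> a}"
    using assms(2,4) by (intro bdd_belowI[of _ y]) (metis antimonoD leD linear mem_Collect_eq order.trans)
  have ne: "{x. l x \<le> a} \<noteq> {}"
    using assms(3) by auto
  have "closed {x. l x \<le> a}"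
    using assms(1) by (intro closed_Collect_le continuous_on_const)
  then have "Inf {x. l x \<le> a} \<in> {x. l x \<le> a}"
    using closed_contains_Inf[OF ne bdd] by blast
  moreover have "Inf {x. l x \<le> a} \<le> x" if "l x \<le> a" for x
    using cInf_lower[OF _ bdd] that by simp
  moreover have "gen_inverse l a = ereal (Inf {x. l x \<le> a})"
    unfolding gen_inverse_def using calculation by (intro cInf_eq_minimum) auto
  ultimately show ?thesis
    using that by auto
qed

section \<open>Extended expectations of functions bounded from below\<close>

lemma (in finite_measure) integrable_AE_bounds:
  fixes X :: "'a \<Rightarrow> real"
  assumes "X \<in> borel_measurable M" "\<And>\<omega>. B \<le> X \<omega>" "AE \<omega> in M. X \<omega> \<le> a"
  shows "integrable M X"
proof (rule integrable_const_bound[OF _ assms(1)])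
  show "AE \<omega> in M. norm (X \<omega>) \<le> \<bar>a\<bar> + \<bar>B\<bar>"
    using assms(3)
  proof eventually_elim
    case (elim \<omega>)
    then show ?case using assms(2)[of \<omega>] by simp
  qed
qed

lemma (in finite_measure) nn_integral_minus_finite:
  assumes "\<And>\<omega>. B \<le> X \<omega>"
  shows "(\<integral>\<^sup>+ \<omega>. ennreal (- X \<omega>) \<partial>M) < \<infinity>"
proof -
  have "(\<integral>\<^sup>+ \<omega>. ennreal (- X \<omega>) \<partial>M) \<le> (\<integral>\<^sup>+ \<omega>. ennreal (- B) \<partial>M)"
    using assms by (intro nn_integral_mono) (simp add: ennreal_leI)
  also have "\<dots> < \<infinity>"
    by (simp add: ennreal_mult_eq_top_iff less_top[symmetric])
  finally show ?thesis .
qed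

lemma (in finite_measure) ereal_expectation_le:
  assumes [measurable]: "X \<in> borel_measurable M"
    and "\<And>\<omega>. B \<le> X \<omega>" "AE \<omega> in M. X \<omega> \<le> a"
  shows "ereal_expectation M (\<lambda>\<omega>. ereal (X \<omega>)) \<le> ereal (a * measure M (space M))"
proof -
  have int: "integrable M X"
    using assms by (rule integrable_AE_bounds)
  have "(\<integral>\<omega>. X \<omega> \<partial>M) \<le> (\<integral>\<omega>. a \<partial>M)"
    using assms(3) int by (intro integral_mono_AE) auto
  then show ?thesis
    by (simp add: ereal_expectation_eq_integral[OF int] mult.commute)
qed

lemma (in finite_measure) integrable_bounded_below:
  assumes [measurable]: "X \<in> borel_measurable M"
    and "\<And>\<omega>. B \<le> X \<omega>" "(\<integral>\<^sup>+ \<omega>. ennreal (X \<omega>) \<partial>M) < \<infinity>"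
  shows "integrable M X"
  using assms(1,3) nn_integral_minus_finite[OF assms(2)] by (simp add: real_integrable_def less_top)

text \<open>The lower bound \<open>B\<close> keeps the integral of the negative part finite, so an
  infinite positive part would make the extended expectation infinite. The constraint itself
  therefore yields integrability.\<close>

lemma (in finite_measure) ereal_expectation_leD:
  assumes [measurable]: "X \<in> borel_measurable M"
    and "\<And>\<omega>. B \<le> X \<omega>" "ereal_expectation M (\<lambda>\<omega>. ereal (X \<omega>)) \<le> ereal a"
  shows "integrable M X" "(\<integral>\<omega>. X \<omega> \<partial>M) \<le> a"
proof -
  have "(\<integral>\<^sup>+ \<omega>. ennreal (- X \<omega>) \<partial>M) < \<infinity>"
    using assms(2) by (rule nn_integral_minus_finite)
  then obtain b where "(\<integral>\<^sup>+ \<omega>. ennreal (- X \<omega>) \<partial>M) = ennreal b" "b \<ge> 0"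
    by (metis ennreal_cases infinity_ennreal_def less_irrefl)
  then have "(\<integral>\<^sup>+ \<omega>. ennreal (X \<omega>) \<partial>M) < \<infinity>"
    using assms(3) by (cases "\<integral>\<^sup>+ \<omega>. ennreal (X \<omega>) \<partial>M") (auto simp: ereal_expectation_def)
  then show int: "integrable M X"
    using assms(1,2) by (intro integrable_bounded_below)
  show "(\<integral>\<omega>. X \<omega> \<partial>M) \<le> a"
    using assms(3) by (simp add: ereal_expectation_eq_integral[OF int])
qed

lemma (in finite_measure_subalgebra) ereal_cond_exp_le:
  assumes [measurable]: "X \<in> borel_measurable M"
    and "\<And>\<omega>. B \<le> X \<omega>" "AE \<omega> in M. X \<omega> \<le> a"
  shows "AE \<omega> in M. ereal_cond_exp M F (\<lambda>\<omega>. ereal (X \<omega>)) \<omega> \<le> ereal a"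
proof -
  have int: "integrable M X"
    using assms by (rule integrable_AE_bounds)
  show ?thesis
    using ereal_cond_exp_eq_real_cond_exp[OF int] real_cond_exp_le_c[OF int assms(3)]
    by eventually_elim simp
qed

text \<open>The lower bound caps the conditional expectation of the negative part by
  \<open>|B|\<close>, hence that of the positive part by \<open>|a| + |B|\<close>. Integrating this
  cap makes \<open>X\<close> integrable; only then can the constraint be read as one on
  \<open>real_cond_exp\<close> and averaged.\<close>

lemma (in finite_measure_subalgebra) ereal_cond_exp_leD:
  assumes [measurable]: "X \<in> borel_measurable M"
    and "\<And>\<omega>. B \<le> X \<omega>" "AE \<omega> in M. ereal_cond_exp M F (\<lambda>\<omega>. ereal (X \<omega>)) \<omega> \<le> ereal a"
  shows "integrable M X" "(\<integral>\<omega>. X \<omega> \<partial>M) \<le> a * measure M (space M)"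
proof -
  have neg: "AE \<omega> in M. nn_cond_exp M F (\<lambda>\<omega>. ennreal (- X \<omega>)) \<omega> \<le> ennreal \<bar>B\<bar>"
  proof -
    have "AE \<omega> in M. nn_cond_exp M F (\<lambda>\<omega>. ennreal (- X \<omega>)) \<omega> \<le> nn_cond_exp M F (\<lambda>\<omega>. ennreal \<bar>B\<bar>) \<omega>"
    proof (rule nn_cond_exp_mono)
      have "- X \<omega> \<le> \<bar>B\<bar>" for \<omega> using assms(2)[of \<omega>] by simp
      then show "AE \<omega> in M. ennreal (- X \<omega>) \<le> ennreal \<bar>B\<bar>"
        by (simp add: ennreal_leI)
    qed measurable
    moreover have "AE \<omega> in M. ennreal \<bar>B\<bar> = nn_cond_exp M F (\<lambda>\<omega>. ennreal \<bar>B\<bar>) \<omega>"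
      by (rule nn_cond_exp_F_meas) measurable
    ultimately show ?thesis by eventually_elim simp
  qed
  have "AE \<omega> in M. nn_cond_exp M F (\<lambda>\<omega>. ennreal (X \<omega>)) \<omega> \<le> ennreal (\<bar>a\<bar> + \<bar>B\<bar>)"
    using neg assms(3)
  proof eventually_elim
    case (elim \<omega>)
    then obtain b where b: "nn_cond_exp M F (\<lambda>\<omega>. ennreal (- X \<omega>)) \<omega> = ennreal b" "b \<ge> 0"
      by (metis ennreal_cases ennreal_less_top leD)
    then have "b \<le> \<bar>B\<bar>" using elim(1) by simp
    show ?case
    proof (cases "nn_cond_exp M F (\<lambda>\<omega>. ennreal (X \<omega>)) \<omega>")
      case (real r)
      then have "r - b \<le> a" using elim(2) b by (simp add: ereal_cond_exp_def)
      then have "r \<le> \<bar>a\<bar> + \<bar>B\<bar>" using \<open>b \<le> \<bar>B\<bar>\<close> by simp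
      then show ?thesis using real by (simp add: ennreal_leI del: ennreal_plus)
    next
      \<comment> \<open>Infinity minus the finite \<open>b\<close> is infinite, contrary to the
        bound \<open>a\<close>.\<close>
      case top
      then show ?thesis using elim(2) b by (simp add: ereal_cond_exp_def)
    qed
  qed
  then have "(\<integral>\<^sup>+ \<omega>. nn_cond_exp M F (\<lambda>\<omega>. ennreal (X \<omega>)) \<omega> \<partial>M) \<le> (\<integral>\<^sup>+ \<omega>. ennreal (\<bar>a\<bar> + \<bar>B\<bar>) \<partial>M)"
    by (rule nn_integral_mono_AE)
  also have "\<dots> < \<infinity>"
    by (simp add: ennreal_mult_eq_top_iff less_top[symmetric])
  \<comment> \<open>With the constant weight 1, the defining identity of \<open>nn_cond_exp\<close>
    says that conditioning preserves the integral.\<close>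
  finally have "(\<integral>\<^sup>+ \<omega>. ennreal (X \<omega>) \<partial>M) < \<infinity>"
    using nn_cond_exp_intg[of "\<lambda>_. 1" "\<lambda>\<omega>. ennreal (X \<omega>)"] by simp
  then show int: "integrable M X"
    using assms(1,2) by (intro integrable_bounded_below)
  have "AE \<omega> in M. real_cond_exp M F X \<omega> \<le> a"
    using ereal_cond_exp_eq_real_cond_exp[OF int] assms(3) by eventually_elim simp
  then have "(\<integral>\<omega>. real_cond_exp M F X \<omega> \<partial>M) \<le> (\<integral>\<omega>. a \<partial>M)"
    using real_cond_exp_int(1)[OF int] by (intro integral_mono_AE) auto
  then show "(\<integral>\<omega>. X \<omega> \<partial>M) \<le> a * measure M (space M)"
    by (simp add: real_cond_exp_int(2)[OF int] mult.commute)
qed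

section \<open>Conditional expectations and supermartingales\<close>

text \<open>The constant \<open>E[Y]\<close> has the same integral as \<open>Y\<close> over every
  set of \<open>F\<close>: such a set is null, and both integrals vanish, or it has full measure,
  and both equal \<open>E[Y]\<close>.\<close>

lemma real_cond_exp_trivial:
  assumes "prob_space P" "subalgebra P F" "trivial_subalgebra P F" "integrable P Y"
  shows "AE \<omega> in P. real_cond_exp P F Y \<omega> = (\<integral>\<omega>. Y \<omega> \<partial>P)"
proof -
  interpret prob_space P by fact
  interpret finite_measure_subalgebra P F by unfold_locales fact
  show ?thesis
  proof (rule real_cond_exp_charact)
    fix A assume A: "A \<in> sets F"
    then have AP: "A \<in> sets P"
      using assms(2) by (auto simp: subalgebra_def)
    consider "prob A = 0" | "prob A = 1"
      using assms(3) A by (auto simp: trivial_subalgebra_def)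
    then show "(\<integral>\<omega>\<in>A. Y \<omega> \<partial>P) = (\<integral>\<omega>\<in>A. (\<integral>\<omega>. Y \<omega> \<partial>P) \<partial>P)"
    proof cases
      case 1
      then have "AE \<omega> in P. \<omega> \<notin> A"
        using AP by (intro AE_not_in) (simp add: emeasure_eq_measure null_setsI)
      then have "AE \<omega> in P. indicator A \<omega> = (0::real)"
        by eventually_elim simp
      then have "(\<integral>\<omega>\<in>A. Z \<omega> \<partial>P) = 0" for Z :: "'a \<Rightarrow> real"
        unfolding set_lebesgue_integral_def by (intro integral_eq_zero_AE) auto
      then show ?thesis by simp
    next
      case 2
      then have "AE \<omega> in P. \<omega> \<in> A"
        using AP by (simp add: prob_eq_1)
      then have ind: "AE \<omega> in P. indicator A \<omega> = (1::real)"
        by eventually_elim simp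
      have "(\<integral>\<omega>\<in>A. Z \<omega> \<partial>P) = (\<integral>\<omega>. Z \<omega> \<partial>P)" if "integrable P Z" for Z :: "'a \<Rightarrow> real"
        unfolding set_lebesgue_integral_def
        using ind that AP by (intro integral_cong_AE) (auto intro: borel_measurable_integrable)
      then show ?thesis
        using assms(4) by (simp add: prob_space)
    qed
  qed (use assms(4) in auto)
qed

lemma (in finite_measure_subalgebra) real_cond_exp_add_const:
  assumes "integrable M Y"
  shows "AE \<omega> in M. real_cond_exp M F (\<lambda>\<omega>. Y \<omega> + c) \<omega> = real_cond_exp M F Y \<omega> + c"
proof -
  have "AE \<omega> in M. real_cond_exp M F (\<lambda>\<omega>. c) \<omega> = c"
    by (rule real_cond_exp_F_meas) auto
  moreover have "AE \<omega> in M. real_cond_exp M F (\<lambda>\<omega>. Y \<omega> + c) \<omega>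
      = real_cond_exp M F Y \<omega> + real_cond_exp M F (\<lambda>\<omega>. c) \<omega>"
    by (rule real_cond_exp_add) (use assms in auto)
  ultimately show ?thesis
    by eventually_elim simp
qed

text \<open>By the tower property this process is even a martingale. With \<open>Y = S n\<close> it
  supplies the process that attains the infimum.\<close>

lemma supermartingale_cond_exp_add_const:
  assumes "prob_space P" "finite_filtration P n F" "integrable P Y"
  shows "supermartingale P n F (\<lambda>k \<omega>. real_cond_exp P (F k) Y \<omega> + c)"
  unfolding supermartingale_def
proof (intro conjI allI impI)
  interpret prob_space P by fact
  have sub: "subalgebra P (F k)" if "k \<le> n" for k
    using assms(2) that by (simp add: finite_filtration_def)
  then have fms: "finite_measure_subalgebra P (F k)" if "k \<le> n" for k
    using that by unfold_locales
  show "(\<lambda>\<omega>. real_cond_exp P (F k) Y \<omega> + c) \<in> borel_measurable (F k)" for k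
    by measurable
  show "integrable P (\<lambda>\<omega>. real_cond_exp P (F k) Y \<omega> + c)" if "k \<le> n" for k
  proof -
    interpret finite_measure_subalgebra P "F k" using fms that .
    show ?thesis using real_cond_exp_int(1)[OF assms(3)] by simp
  qed
  show "AE \<omega> in P. real_cond_exp P (F j) (\<lambda>\<omega>. real_cond_exp P (F k) Y \<omega> + c) \<omega>
      \<le> real_cond_exp P (F j) Y \<omega> + c" if "j \<le> k \<and> k \<le> n" for j k
  proof -
    interpret j: finite_measure_subalgebra P "F j" using fms that by simp
    interpret k: finite_measure_subalgebra P "F k" using fms that by simp
    have "subalgebra (F k) (F j)"
      using assms(2) sub[of j] sub[of k] that by (auto simp: finite_filtration_def subalgebra_def)
    then have "AE \<omega> in P. real_cond_exp P (F j) (real_cond_exp P (F k) Y) \<omega> = real_cond_exp P (F j) Y \<omega>"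
      using sub that assms(3) by (intro j.real_cond_exp_nested_subalg) auto
    with j.real_cond_exp_add_const[OF k.real_cond_exp_int(1)[OF assms(3)], of c]
    show ?thesis by eventually_elim simp
  qed
qed

lemma supermartingale_initial_ge:
  assumes "prob_space P" "finite_filtration P n F" "trivial_subalgebra P (F 0)"
    and "supermartingale P n F M" "AE \<omega> in P. M 0 \<omega> = m"
  shows "(\<integral>\<omega>. M n \<omega> \<partial>P) \<le> m"
proof -
  interpret prob_space P by fact
  have le: "AE \<omega> in P. real_cond_exp P (F 0) (M n) \<omega> \<le> M 0 \<omega>" and int: "integrable P (M n)"
    using assms(4) by (auto simp: supermartingale_def)
  have "AE \<omega> in P. real_cond_exp P (F 0) (M n) \<omega> = (\<integral>\<omega>. M n \<omega> \<partial>P)"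
    using assms int by (intro real_cond_exp_trivial) (auto simp: finite_filtration_def)
  with le assms(5) have "AE \<omega> in P. (\<integral>\<omega>. M n \<omega> \<partial>P) \<le> m"
    by eventually_elim simp
  \<comment> \<open>An inequality between constants that holds almost surely on a probability space
    holds outright.\<close>
  then show ?thesis by simp
qed

section \<open>Infima of initial values and comparison of the three constraints\<close>

lemma inf_initial_value_eqI:
  assumes "\<And>M m. M \<in> A \<Longrightarrow> AE \<omega> in P. M 0 \<omega> = m \<Longrightarrow> v \<le> ereal m"
    and "M \<in> A" "AE \<omega> in P. M 0 \<omega> = m" "ereal m = v"
  shows "inf_initial_value P A = v"
  unfolding inf_initial_value_def using assms by (intro cInf_eq_minimum) auto

lemma inf_initial_value_eq_MInfty:
  assumes "\<And>m. (\<lambda>_ _. m) \<in> A"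
  shows "inf_initial_value P A = -\<infinity>"
proof -
  have "inf_initial_value P A \<le> ereal m" for m
    unfolding inf_initial_value_def
    by (rule Inf_lower, rule CollectI, rule exI[of _ m], rule exI[of _ "\<lambda>_ _. m"]) (auto simp: assms)
  then show ?thesis
    by (rule ereal_bot)
qed

text \<open>The term \<open>k = n\<close> is dominated by the maximum \<open>Z\<close>. Since
  \<open>Z\<close> is bounded below, its constraint makes it integrable with nonpositive integral,
  and both facts pass to that term.\<close>

lemma M_LB_integral_le:
  assumes "prob_space P" "n \<ge> 1" "\<And>k. k \<le> n \<Longrightarrow> integrable P (S k)"
    and l: "l \<in> borel_measurable borel" "\<And>x. B \<le> l x"
    and M: "M \<in> M_LB P P n F S l \<alpha>"
  shows "integrable P (\<lambda>\<omega>. l (M n \<omega> - S n \<omega>))" "(\<integral>\<omega>. l (M n \<omega> - S n \<omega>) \<partial>P) \<le> \<alpha> n"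
proof -
  interpret prob_space P by fact
  note [measurable] = l(1)
  have intM: "integrable P (M k)" if "k \<le> n" for k
    using M that by (auto simp: M_LB_def supermartingale_def)
  have meas[measurable]: "(\<lambda>\<omega>. l (M k \<omega> - S k \<omega>)) \<in> borel_measurable P" if "k \<le> n" for k
  proof -
    have [measurable]: "M k \<in> borel_measurable P" "S k \<in> borel_measurable P"
      using intM[OF that] assms(3)[OF that] by auto
    show ?thesis by measurable
  qed
  define Z where "Z \<omega> = (MAX k\<in>{1..n}. l (M k \<omega> - S k \<omega>) - \<alpha> k)" for \<omega>
  have Z_ge: "l (M n \<omega> - S n \<omega>) - \<alpha> n \<le> Z \<omega>" for \<omega>
    unfolding Z_def using assms(2) by (intro Max_ge) auto
  have Z_meas: "Z \<in> borel_measurable P"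
    unfolding Z_def by (rule borel_measurable_Max) auto
  have Z_B: "B - \<alpha> n \<le> Z \<omega>" for \<omega>
    using Z_ge[of \<omega>] l(2)[of "M n \<omega> - S n \<omega>"] by simp
  have "ereal_expectation P (\<lambda>\<omega>. ereal (Z \<omega>)) \<le> ereal 0"
    using M by (simp add: M_LB_def Z_def zero_ereal_def)
  note Z = ereal_expectation_leD[OF Z_meas Z_B this]
  show int: "integrable P (\<lambda>\<omega>. l (M n \<omega> - S n \<omega>))"
  proof (rule Bochner_Integration.integrable_bound)
    \<comment> \<open>This function dominates because \<open>B \<le> l (M n \<omega> - S n \<omega>)
      \<le> Z \<omega> + \<alpha> n\<close>.\<close>
    show "integrable P (\<lambda>\<omega>. \<bar>Z \<omega>\<bar> + (\<bar>\<alpha> n\<bar> + \<bar>B\<bar>))"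
      using Z(1) by simp
    have "norm (l (M n \<omega> - S n \<omega>)) \<le> norm (\<bar>Z \<omega>\<bar> + (\<bar>\<alpha> n\<bar> + \<bar>B\<bar>))" for \<omega>
      using Z_ge[of \<omega>] l(2)[of "M n \<omega> - S n \<omega>"] by simp
    then show "AE \<omega> in P. norm (l (M n \<omega> - S n \<omega>)) \<le> norm (\<bar>Z \<omega>\<bar> + (\<bar>\<alpha> n\<bar> + \<bar>B\<bar>))"
      by simp
  qed simp
  have "(\<integral>\<omega>. l (M n \<omega> - S n \<omega>) - \<alpha> n \<partial>P) \<le> (\<integral>\<omega>. Z \<omega> \<partial>P)"
    using Z_ge int Z(1) by (intro integral_mono) auto
  then show "(\<integral>\<omega>. l (M n \<omega> - S n \<omega>) \<partial>P) \<le> \<alpha> n"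
    using int Z(2) by (simp add: prob_space)
qed

text \<open>This is all that the lower bound on \<open>M 0\<close> uses of the constraints, so one
  argument serves all three sets. For \<open>M_TC\<close> the conditional constraint at time
  \<open>n\<close> is averaged over \<open>F (n - 1)\<close>.\<close>

lemma admissible_integral_le:
  assumes "prob_space P" "n \<ge> 1" "\<And>k. k \<le> n \<Longrightarrow> integrable P (S k)"
    and l: "l \<in> borel_measurable borel" "\<And>x. B \<le> l x"
    and F: "\<And>k. k \<le> n \<Longrightarrow> subalgebra P (F k)"
    and M: "M \<in> M_EU P P n F S l \<alpha> \<union> M_TC P P n F S l \<alpha> \<union> M_LB P P n F S l \<alpha>"
  shows "integrable P (\<lambda>\<omega>. l (M n \<omega> - S n \<omega>)) \<and> (\<integral>\<omega>. l (M n \<omega> - S n \<omega>) \<partial>P) \<le> \<alpha> n"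
proof -
  interpret prob_space P by fact
  note [measurable] = l(1)
  have [measurable]: "M n \<in> borel_measurable P" "S n \<in> borel_measurable P"
    using M assms(3)[of n] by (auto simp: M_EU_def M_TC_def M_LB_def supermartingale_def)
  have meas: "(\<lambda>\<omega>. l (M n \<omega> - S n \<omega>)) \<in> borel_measurable P"
    by measurable
  consider "M \<in> M_EU P P n F S l \<alpha>" | "M \<in> M_TC P P n F S l \<alpha>" | "M \<in> M_LB P P n F S l \<alpha>"
    using M by auto
  then show ?thesis
  proof cases
    case 1
    then have "ereal_expectation P (\<lambda>\<omega>. ereal (l (M n \<omega> - S n \<omega>))) \<le> ereal (\<alpha> n)"
      using assms(2) by (simp add: M_EU_def)
    then show ?thesis
      using ereal_expectation_leD[OF meas l(2)] by simp
  next
    case 2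
    interpret finite_measure_subalgebra P "F (n - 1)"
      by unfold_locales (simp add: F)
    have "AE \<omega> in P. ereal_cond_exp P (F (n - 1)) (\<lambda>\<omega>. ereal (l (M n \<omega> - S n \<omega>))) \<omega> \<le> ereal (\<alpha> n)"
      using 2 assms(2) by (simp add: M_TC_def)
    then show ?thesis
      using ereal_cond_exp_leD[OF meas l(2)] by (simp add: prob_space)
  next
    case 3
    then show ?thesis
      using M_LB_integral_le[where S = S, OF assms(1-3) l] by blast
  qed
qed

text \<open>An almost sure bound survives expectation and conditional expectation, and makes every
  term of the maximum nonpositive. The lower bound on \<open>l\<close> supplies the
  integrability.\<close>

lemma admissibleI:
  assumes "prob_space P" "n \<ge> 1" "\<And>k. k \<le> n \<Longrightarrow> integrable P (S k)"
    and l: "l \<in> borel_measurable borel" "\<And>x. B \<le> l x"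
    and F: "\<And>k. k \<le> n \<Longrightarrow> subalgebra P (F k)"
    and M: "supermartingale P n F M"
    and le: "\<And>k. k \<in> {1..n} \<Longrightarrow> AE \<omega> in P. l (M k \<omega> - S k \<omega>) \<le> \<alpha> k"
  shows "M \<in> M_EU P P n F S l \<alpha>" "M \<in> M_TC P P n F S l \<alpha>" "M \<in> M_LB P P n F S l \<alpha>"
proof -
  interpret prob_space P by fact
  note [measurable] = l(1)
  have meas: "(\<lambda>\<omega>. l (M k \<omega> - S k \<omega>)) \<in> borel_measurable P" if "k \<le> n" for k
  proof -
    have [measurable]: "M k \<in> borel_measurable P" "S k \<in> borel_measurable P"
      using M that assms(3)[of k] by (auto simp: supermartingale_def)
    show ?thesis by measurable
  qed
  show "M \<in> M_EU P P n F S l \<alpha>"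
    using M ereal_expectation_le[OF meas l(2) le] by (simp add: M_EU_def prob_space)
  have "AE \<omega> in P. ereal_cond_exp P (F (k - 1)) (\<lambda>\<omega>. ereal (l (M k \<omega> - S k \<omega>))) \<omega> \<le> ereal (\<alpha> k)"
    if k: "k \<in> {1..n}" for k
  proof -
    interpret finite_measure_subalgebra P "F (k - 1)"
      using k by unfold_locales (auto intro: F)
    show ?thesis
      using ereal_cond_exp_le[OF meas l(2) le[OF k]] k by simp
  qed
  then show "M \<in> M_TC P P n F S l \<alpha>"
    using M by (simp add: M_TC_def)
  define Z where "Z \<omega> = (MAX k\<in>{1..n}. l (M k \<omega> - S k \<omega>) - \<alpha> k)" for \<omega>
  have "l (M n \<omega> - S n \<omega>) - \<alpha> n \<le> Z \<omega>" for \<omega>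
    unfolding Z_def using assms(2) by (intro Max_ge) auto
  then have Z_B: "B - \<alpha> n \<le> Z \<omega>" for \<omega>
    using l(2)[of "M n \<omega> - S n \<omega>"] by (smt (verit))
  have Z_meas: "Z \<in> borel_measurable P"
    unfolding Z_def using meas by (intro borel_measurable_Max) auto
  \<comment> \<open>The finitely many exceptional null sets are merged, so that one event controls
    the whole maximum.\<close>
  have "AE \<omega> in P. \<forall>k\<in>{1..n}. l (M k \<omega> - S k \<omega>) \<le> \<alpha> k"
    using le by (simp add: AE_ball_countable)
  then have "AE \<omega> in P. Z \<omega> \<le> 0"
    by eventually_elim (use assms(2) in \<open>auto simp: Z_def\<close>)
  then have "ereal_expectation P (\<lambda>\<omega>. ereal (Z \<omega>)) \<le> 0"
    using ereal_expectation_le[OF Z_meas Z_B, of 0] by (simp add: zero_ereal_def)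
  then show "M \<in> M_LB P P n F S l \<alpha>"
    using M by (simp add: M_LB_def Z_def)
qed

section \<open>The common value of the three infima\<close>

theorem proposition4:
  fixes P Q :: "'a measure"
    and F :: "nat \<Rightarrow> 'a measure"
    and n :: nat
    and X S :: "nat \<Rightarrow> 'a \<Rightarrow> real"
    and l :: "real \<Rightarrow> real"
    and \<alpha> :: "nat \<Rightarrow> real"
  assumes "prob_space P" and "prob_space Q" and "equivalent_measures P Q"
    and "n \<ge> 1"
    and "finite_filtration P n F" and "trivial_subalgebra P (F 0)"
    and "\<And>i. i \<in> {1..n} \<Longrightarrow> X i \<in> borel_measurable (F i)"
    and "\<And>i. i \<in> {1..n} \<Longrightarrow> integrable Q (X i)"
    and "S = partial_sum X"
    and "convex_on UNIV l" and "antimono l" and "bdd_below (range l)"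
    and "P = Q"
    and "\<And>k. k \<in> {1..n} \<Longrightarrow> \<alpha> k > Lim at_top l"
    and "\<And>k. k \<in> {1..n} \<Longrightarrow>
      AE \<omega> in P. ereal_cond_exp P (F k) (\<lambda>\<omega>. ereal (S n \<omega>) + gen_inverse l (\<alpha> n)) \<omega>
                   \<ge> ereal (S k \<omega>) + gen_inverse l (\<alpha> k)"
  shows "V_EU P Q n F S l \<alpha> = V_TC P Q n F S l \<alpha> \<and>
         V_TC P Q n F S l \<alpha> = V_LB P Q n F S l \<alpha> \<and>
         V_LB P Q n F S l \<alpha> = ereal (\<integral>\<omega>. S n \<omega> \<partial>P) + gen_inverse l (\<alpha> n)"
proof -
  interpret prob_space P by fact
  have [simp]: "Q = P" using assms(13) by simp
  have F: "\<And>k. k \<le> n \<Longrightarrow> subalgebra P (F k)"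
    using assms(5) by (simp add: finite_filtration_def)
  obtain B where B: "\<And>x. B \<le> l x"
    using assms(12) by (auto simp: bdd_below_def)
  have cont: "continuous_on UNIV l"
    using assms(10) by (intro convex_on_continuous) auto
  then have l: "l \<in> borel_measurable borel"
    by (rule borel_measurable_continuous_onI)
  have int: "integrable P (S k)" if "k \<le> n" for k
    unfolding assms(9) partial_sum_def using assms(8) that by (intro Bochner_Integration.integrable_sum) auto
  have less: "\<exists>x. l x < \<alpha> k" if "k \<in> {1..n}" for k
    using antimono_less_Lim_at_top assms(11,12,14) that by blast
  let ?v = "ereal (\<integral>\<omega>. S n \<omega> \<partial>P) + gen_inverse l (\<alpha> n)"
  have "inf_initial_value P A = ?v"
    if A: "A \<in> {M_EU P P n F S l \<alpha>, M_TC P P n F S l \<alpha>, M_LB P P n F S l \<alpha>}" for A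
  proof (cases "\<forall>x y. l x = l y")
    case True
    then have le: "l x \<le> \<alpha> k" if "k \<in> {1..n}" for x k
      using less[OF that] by (metis less_imp_le)
    \<comment> \<open>A constant \<open>l\<close> has every real number in its sublevel set, whose
      infimum is then below every real.\<close>
    have "gen_inverse l (\<alpha> n) = -\<infinity>"
    proof -
      have "Inf (range ereal) \<le> ereal r" for r
        by (intro Inf_lower) simp
      then show ?thesis
        using le assms(4) by (simp add: gen_inverse_def ereal_bot)
    qed
    moreover have "(\<lambda>_ _. m) \<in> A" for m
    proof -
      have "supermartingale P n F (\<lambda>_ _. m)"
        unfolding supermartingale_def
      proof (intro conjI allI impI)
        fix j k assume "j \<le> k \<and> k \<le> n"
        then interpret finite_measure_subalgebra P "F j"
          by unfold_locales (auto intro: F)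
        have "AE \<omega> in P. real_cond_exp P (F j) (\<lambda>_. m) \<omega> = m"
          by (rule real_cond_exp_F_meas) auto
        then show "AE \<omega> in P. real_cond_exp P (F j) (\<lambda>_. m) \<omega> \<le> m"
          by eventually_elim simp
      qed auto
      then show ?thesis
        using admissibleI[where S = S and F = F and M = "\<lambda>_ _. m" and \<alpha> = \<alpha>, OF assms(1,4) int l B F] le A by auto
    qed
    ultimately show ?thesis
      by (simp add: inf_initial_value_eq_MInfty)
  next
    case False
    then obtain x y where xy: "l x \<noteq> l y" by blast
    have "\<exists>c. gen_inverse l (\<alpha> k) = ereal c \<and> l c \<le> \<alpha> k \<and> (\<forall>x. l x \<le> \<alpha> k \<longrightarrow> c \<le> x)"
      if k: "k \<in> {1..n}" for k
    proof -
      obtain x' y' where "l x' \<le> \<alpha> k" "\<alpha> k < l y'"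
        using less[OF k] convex_on_antimono_unbounded[OF assms(10,11) xy] less_imp_le by metis
      from gen_inverse_eq_ereal[OF cont assms(11) this] show ?thesis by metis
    qed
    \<comment> \<open>With real minima \<open>c k\<close> the extended-real hypothesis turns into
      one about ordinary conditional expectations.\<close>
    then obtain c where c: "\<And>k. k \<in> {1..n} \<Longrightarrow> gen_inverse l (\<alpha> k) = ereal (c k)"
        "\<And>k. k \<in> {1..n} \<Longrightarrow> l (c k) \<le> \<alpha> k"
        "\<And>k x. k \<in> {1..n} \<Longrightarrow> l x \<le> \<alpha> k \<Longrightarrow> c k \<le> x"
      by metis
    have n: "n \<in> {1..n}" using assms(4) by simp
    define N where "N k \<omega> = real_cond_exp P (F k) (S n) \<omega> + c n" for k \<omega>
    show ?thesis
    proof (rule inf_initial_value_eqI)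
      show "N \<in> A"
      proof -
        have "supermartingale P n F N"
          unfolding N_def using assms(1,5) int by (intro supermartingale_cond_exp_add_const) auto
        moreover have "AE \<omega> in P. l (N k \<omega> - S k \<omega>) \<le> \<alpha> k" if k: "k \<in> {1..n}" for k
        proof -
          interpret finite_measure_subalgebra P "F k"
            using k by unfold_locales (auto intro: F)
          have int': "integrable P (\<lambda>\<omega>. S n \<omega> + c n)"
            using int by simp
          show ?thesis
            using assms(15)[OF k] ereal_cond_exp_eq_real_cond_exp[OF int']
              real_cond_exp_add_const[OF int[OF order_refl], of "c n"]
          proof eventually_elim
            case (elim \<omega>)
            \<comment> \<open>The integrand in the hypothesis is now the real function
              \<open>S n + c n\<close>, whose conditional expectation given \<open>F k\<close> is
              \<open>N k\<close>.\<close>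
            then have "c k \<le> N k \<omega> - S k \<omega>"
              by (simp add: c(1)[OF k] c(1)[OF n] N_def)
            then show ?case
              using antimonoD[OF assms(11)] c(2)[OF k] order_trans by blast
          qed
        qed
        ultimately show ?thesis
          using admissibleI[where S = S and F = F and M = N and \<alpha> = \<alpha>, OF assms(1,4) int l B F] A by auto
      qed
      \<comment> \<open>Triviality of \<open>F 0\<close> makes \<open>N 0\<close> almost surely
        constant, as \<open>inf_initial_value\<close> requires.\<close>
      show "AE \<omega> in P. N 0 \<omega> = (\<integral>\<omega>. S n \<omega> \<partial>P) + c n"
        using real_cond_exp_trivial[OF assms(1) F assms(6) int] by (simp add: N_def)
      show "ereal ((\<integral>\<omega>. S n \<omega> \<partial>P) + c n) = ?v"
        by (simp add: c(1)[OF n])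
    next
      fix M m assume M: "M \<in> A" and m: "AE \<omega> in P. M 0 \<omega> = m"
      have sm: "supermartingale P n F M"
        using M A by (auto simp: M_EU_def M_TC_def M_LB_def)
      then have intM: "integrable P (M n)"
        by (simp add: supermartingale_def)
      have "integrable P (\<lambda>\<omega>. l (M n \<omega> - S n \<omega>)) \<and> (\<integral>\<omega>. l (M n \<omega> - S n \<omega>) \<partial>P) \<le> \<alpha> n"
        by (rule admissible_integral_le[where S = S and F = F, OF assms(1,4) int l B F]) (use M A in auto)
      moreover have "integrable P (\<lambda>\<omega>. M n \<omega> - S n \<omega>)"
        using intM int by simp
      \<comment> \<open>Jensen's inequality puts the mean of \<open>M n - S n\<close> into the
        sublevel set of \<open>l\<close> at \<open>\<alpha> n\<close>, of which \<open>c n\<close>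
        is the least element.\<close>
      ultimately have "l (\<integral>\<omega>. M n \<omega> - S n \<omega> \<partial>P) \<le> \<alpha> n"
        using jensens_inequality[of "\<lambda>\<omega>. M n \<omega> - S n \<omega>" UNIV _ _ l] assms(10) by auto
      then have "c n \<le> (\<integral>\<omega>. M n \<omega> \<partial>P) - (\<integral>\<omega>. S n \<omega> \<partial>P)"
        using c(3)[OF n] intM int by simp
      then show "?v \<le> ereal m"
        using supermartingale_initial_ge[OF assms(1,5,6) sm m] by (simp add: c(1)[OF n])
    qed
  qed
  then show ?thesis
    by (simp add: V_EU_def V_TC_def V_LB_def)
qed

end
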